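(* Let $\alpha\in\mathbb{R}$ and define, on a domain $\mathrm{dom}\,\Psi\subseteq\mathbb{R}$ specified below, the function (an antiderivative of the extended exponential function $\exp_\alpha$, additive constants being dropped) $$\Psi(x)=\int_d^x\exp_\alpha(\xi)\,d\xi=\begin{cases}\exp(x) & \text{if }\alpha=1,\\ -\ln(-x) & \text{if }\alpha=2,\\ \dfrac{1}{2-\alpha}\big[(1-\alpha)x\big]^{\frac{2-\alpha}{1-\alpha}} & \text{otherwise.}\end{cases}$$ Then $\Psi$ is a convex function of Legendre type on $\mathrm{dom}\,\Psi$ in each of the following cases: I. (entire region) $\alpha<1$, $\alpha\in\mathbb{R}_e$, and $\mathrm{dom}\,\Psi=\mathbb{R}$; or $\alpha=1$ and $\mathrm{dom}\,\Psi=\mathbb{R}$. II. (positive region) $1<\alpha<2$, $\alpha\in\mathbb{R}_e$, and $\mathrm{dom}\,\Psi=\mathbb{R}_{++}$; or $\alpha>2$, $\alpha\in\mathbb{R}_e$, and $\mathrm{dom}\,\Psi=\mathbb{R}_{+}$. III. (negative region) $1<\alpha\le 2$ and $\mathrm{dom}\,\Psi=\mathbb{R}_{--}$; or $\alpha>2$ and $\mathrm{dom}\,\Psi=\mathbb{R}_{-}$.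
   Context: Notation: $\mathbb{R}_+=\{x\ge 0\}$, $\mathbb{R}_{++}=\{x>0\}$, $\mathbb{R}_-=\{x\le 0\}$, $\mathbb{R}_{--}=\{x<0\}$, and $\mathbb{R}_e=\{2k/(2l+1) : k,l\in\mathbb{Z}\}$. Extended exponential function: $\exp_\alpha(x)=\exp(x)$ if $\alpha=1$ and $\exp_\alpha(x)=((1-\alpha)x)^{1/(1-\alpha)}$ if $\alpha\ne1$, with the domain $\mathbb{R}$ if $\alpha=1$ or ($\alpha<1$, $\alpha\in\mathbb{R}_e$); $\mathbb{R}_+$ if $\alpha<1$, $\alpha\notin\mathbb{R}_e$; $\mathbb{R}_{--}$ or $\mathbb{R}_{++}$ (either choice) if $\alpha>1$, $\alpha\in\mathbb{R}_e$; $\mathbb{R}_{--}$ if $\alpha>1$, $\alpha\notin\mathbb{R}_e$. Convention for real powers: for $x>0$, $x^r$ is the usual power; $0^r=0$ for $r>0$; for $x<0$ and rational $r=p/q$ with $p,q\in\mathbb{Z}$ and $q$ odd, $x^{r}=|x|^r$ if $p$ is even and $x^r=-|x|^r$ if $p$ is odd. Convex function of Legendre type: a lower semicontinuous, convex, proper function $f:\mathrm{dom}\,f\to\mathbb{R}$, $\mathrm{dom}\,f\subseteq\mathbb{R}$ convex, is a convex function of Legendre type if (i) $\mathrm{int}(\mathrm{dom}\,f)\ne\emptyset$ and $f$ is strictly convex and differentiable on $\mathrm{int}(\mathrm{dom}\,f)$; and (ii) (steepness) for all $x\in\mathrm{bd}(\mathrm{dom}\,f)$ and all $y\in\mathrm{int}(\mathrm{dom}\,f)$,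 $\lim_{t\downarrow0} f'(x+t(y-x))\,(y-x)=-\infty$. *)

theory Defs
  imports "HOL-Analysis.Analysis"
begin

definition even_over_odd :: "real set" where
  "even_over_odd = {of_int (2 * k) / of_int (2 * l + 1) | k l :: int. True}"

(* Unlike powr, this is also meaningful for negative bases when the exponent has a representation
   with odd denominator; all such representations of r have numerators of the same parity.
   Outside the range of the convention the value is left unspecified. *)
definition rpow :: "real \<Rightarrow> real \<Rightarrow> real" where
  "rpow x r =
    (if x > 0 then x powr r
     else if x = 0 then (if r > 0 then 0 else undefined)
     else if \<exists>p q :: int. odd q \<and> even p \<and> r = of_int p / of_int q then \<bar>x\<bar> powr r
     else if \<exists>p q :: int. odd q \<and> odd p \<and> r = of_int p / of_int q then - (\<bar>x\<bar> powr r)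
     else undefined)"

(* Meaningful only for x in the domain of exp_alpha: all reals if a = 1 or (a < 1 and
   a in even_over_odd), x \<ge> 0 for the other a < 1, x < 0 or x > 0 if a > 1 and a in even_over_odd,
   and x < 0 for the other a > 1. *)
definition exp_ext :: "real \<Rightarrow> real \<Rightarrow> real" where
  "exp_ext a x = (if a = 1 then exp x else rpow ((1 - a) * x) (1 / (1 - a)))"

definition Psi :: "real \<Rightarrow> real \<Rightarrow> real" where
  "Psi a x =
    (if a = 1 then exp x
     else if a = 2 then - ln (- x)
     else 1 / (2 - a) * rpow ((1 - a) * x) ((2 - a) / (1 - a)))"

(* A function f : D \<rightarrow> real is identified with its extension by +\<infinity>. *)
definition ext_infinity :: "real set \<Rightarrow> (real \<Rightarrow> real) \<Rightarrow> real \<Rightarrow> ereal" where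
  "ext_infinity D f x = (if x \<in> D then ereal (f x) else \<infinity>)"

(* at x is the punctured neighbourhood filter; leaving out x itself does not change the notion. *)
definition lower_semicontinuous :: "(real \<Rightarrow> ereal) \<Rightarrow> bool" where
  "lower_semicontinuous g \<longleftrightarrow> (\<forall>x. g x \<le> Liminf (at x) g)"

definition strictly_convex_on :: "real set \<Rightarrow> (real \<Rightarrow> real) \<Rightarrow> bool" where
  "strictly_convex_on S f \<longleftrightarrow> convex S \<and>
    (\<forall>x\<in>S. \<forall>y\<in>S. \<forall>u>0. \<forall>v>0. x \<noteq> y \<longrightarrow> u + v = 1 \<longrightarrow> f (u * x + v * y) < u * f x + v * f y)"

(* D is the effective domain; as f is real-valued on D, properness is D \<noteq> {}.
   Convexity of D is part of convex_on. *)
definition convex_legendre :: "real set \<Rightarrow> (real \<Rightarrow> real) \<Rightarrow> bool" where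
  "convex_legendre D f \<longleftrightarrow>
    D \<noteq> {} \<and> convex_on D f \<and> lower_semicontinuous (ext_infinity D f) \<and>
    interior D \<noteq> {} \<and> strictly_convex_on (interior D) f \<and>
    (\<forall>x\<in>interior D. f differentiable (at x)) \<and>
    (\<forall>x\<in>frontier D. \<forall>y\<in>interior D.
       filterlim (\<lambda>t. deriv f (x + t * (y - x)) * (y - x)) at_bot (at_right 0))"

end

theory Submission
  imports Defs
begin

text \<open>
  On the interior of its domain \<^term>\<open>Psi \<alpha>\<close> has derivative \<^term>\<open>exp_ext \<alpha>\<close>, which is strictly
  increasing, and \<^term>\<open>Psi \<alpha>\<close> is continuous on the whole domain; the mean value theorem then gives
  strict convexity, and the fundamental theorem of calculus gives the integral. Wherever
  \<open>(1 - \<alpha>) x > 0\<close> everything is about ordinary powers. For \<open>\<alpha>\<close> with even numerator and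
  odd denominator \<^term>\<open>Psi \<alpha>\<close> is even (if \<open>\<alpha> \<noteq> 2\<close>) and \<^term>\<open>exp_ext \<alpha>\<close> is odd, so the
  remaining half-line follows by reflection.
\<close>

section \<open>A criterion for functions of Legendre type\<close>

text \<open>The mean value theorem turns the secant slopes on the two sides of \<open>z\<close> into
  values of \<open>f'\<close> at points left and right of \<open>z\<close>. Denominators are cleared
  to suit convex combinations.\<close>

lemma mean_value_strict_mono_deriv:
  fixes f f' :: "real \<Rightarrow> real"
  assumes "x < z" "z < y" and cont: "continuous_on {x..y} f"
    and der: "\<And>w. w \<in> {x<..<y} \<Longrightarrow> (f has_real_derivative f' w) (at w)"
    and mono: "strict_mono_on {x<..<y} f'"
  shows "(f z - f x) * (y - z) < (f y - f z) * (z - x)"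
proof -
  have mvt: "\<exists>w. p < w \<and> w < q \<and> f q - f p = (q - p) * f' w"
    if "p < q" "x \<le> p" "q \<le> y" for p q
  proof -
    have "continuous_on {p..q} f"
      using cont by (rule continuous_on_subset) (use that in auto)
    moreover have "(f has_real_derivative f' w) (at w)" if "p < w" "w < q" for w
      using der that \<open>x \<le> p\<close> \<open>q \<le> y\<close> by auto
    ultimately obtain l w where "p < w" "w < q" "(f has_real_derivative l) (at w)"
      "f q - f p = (q - p) * l"
      using MVT[OF \<open>p < q\<close>] by (metis real_differentiable_def)
    \<comment> \<open>\<open>MVT\<close> only yields some derivative \<open>l\<close> at
      \<open>w\<close>; uniqueness of derivatives identifies it with \<open>f' w\<close>.\<close>
    then show ?thesis
      using der[of w] that DERIV_unique by fastforce
  qed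
  obtain a b where a: "x < a" "a < z" "f z - f x = (z - x) * f' a"
    and b: "z < b" "b < y" "f y - f z = (y - z) * f' b"
    using mvt[of x z] mvt[of z y] assms(1,2) by fastforce
  have "f' a < f' b"
    using mono a b by (auto simp: strict_mono_on_def)
  then show ?thesis
    using assms(1,2) unfolding a(3) b(3) by (simp add: mult_ac)
qed

text \<open>The open segment between two points of a convex \<open>D\<close> lies in the interior of
  \<open>D\<close>, so boundary points enter only through the continuity of
  \<open>f\<close>.\<close>

lemma strictly_convex_on_if_strict_mono_deriv:
  fixes f f' :: "real \<Rightarrow> real"
  assumes D: "convex D" and cont: "continuous_on D f"
    and der: "\<And>x. x \<in> interior D \<Longrightarrow> (f has_real_derivative f' x) (at x)"
    and mono: "strict_mono_on (interior D) f'"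
  shows "strictly_convex_on D f"
proof -
  have less: "f (u * x + v * y) < u * f x + v * f y"
    if xy: "x \<in> D" "y \<in> D" "x < y" and uv: "0 < u" "0 < v" "u + v = 1" for x y u v :: real
  proof -
    define z where "z = u * x + v * y"
    have u: "u = 1 - v" using uv by simp
    \<comment> \<open>Both differences are multiples of \<open>y - x\<close>, which then cancels
      from the secant inequality.\<close>
    have zx: "z - x = v * (y - x)" and yz: "y - z = u * (y - x)"
      unfolding z_def u by (simp_all add: algebra_simps)
    have sub: "{x..y} \<subseteq> D"
      using D xy by (metis closed_segment_eq_real_ivl1 convex_contains_segment less_imp_le)
    then have int: "{x<..<y} \<subseteq> interior D"
      by (intro interior_maximal) auto
    have "x < z" "z < y"
      using zx yz uv xy(3) by (metis diff_gt_0_iff_gt mult_pos_pos)+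
    moreover have "continuous_on {x..y} f"
      using cont sub by (rule continuous_on_subset)
    moreover have "strict_mono_on {x<..<y} f'"
      using mono int unfolding strict_mono_on_def by blast
    ultimately have "(f z - f x) * (y - z) < (f y - f z) * (z - x)"
      using der int by (intro mean_value_strict_mono_deriv[where f' = f']) auto
    then have "((f z - f x) * u) * (y - x) < ((f y - f z) * v) * (y - x)"
      unfolding zx yz by (simp add: mult_ac)
    then have "(f z - f x) * u < (f y - f z) * v"
      using xy(3) by (simp add: mult_less_cancel_right)
    then have "f z < u * f x + v * f y"
      unfolding u by (simp add: algebra_simps)
    then show ?thesis
      unfolding z_def .
  qed
  show ?thesis
    unfolding strictly_convex_on_def
  proof (intro conjI D ballI allI impI)
    fix x y u v :: real
    assume *: "x \<in> D" "y \<in> D" "0 < u" "0 < v" "x \<noteq> y" "u + v = 1"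
    show "f (u * x + v * y) < u * f x + v * f y"
    proof (cases "x < y")
      case True
      then show ?thesis using less * by blast
    next
      case False
      then show ?thesis using less[of y x v u] * by (simp add: add.commute)
    qed
  qed
qed

lemma strictly_convex_on_imp_convex_on:
  assumes "strictly_convex_on S f"
  shows "convex_on S f"
proof (rule convex_onI)
  show "convex S"
    using assms by (simp add: strictly_convex_on_def)
  fix t x y :: real
  assume "0 < t" "t < 1" "x \<in> S" "y \<in> S"
  then have "f ((1 - t) * x + t * y) < (1 - t) * f x + t * f y" if "x \<noteq> y"
    using assms that unfolding strictly_convex_on_def by simp
  then show "f ((1 - t) *\<^sub>R x + t *\<^sub>R y) \<le> (1 - t) * f x + t * f y"
    by (cases "x = y") (auto simp: distrib_right[symmetric] intro: less_imp_le)
qed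

lemma strictly_convex_on_subset:
  "strictly_convex_on S f \<Longrightarrow> T \<subseteq> S \<Longrightarrow> convex T \<Longrightarrow> strictly_convex_on T f"
  unfolding strictly_convex_on_def by blast

text \<open>Off \<open>D\<close> the extension is infinite, so only the behaviour within
  \<open>D\<close> counts: \<open>f\<close> is continuous at points of \<open>D\<close> and tends to
  infinity at missing boundary points, and points outside the closure have no points of
  \<open>D\<close> nearby.\<close>

lemma lower_semicontinuous_ext_infinity:
  assumes cont: "continuous_on D f"
    and lim: "\<And>x. x \<in> closure D - D \<Longrightarrow> filterlim f at_top (at x within D)"
  shows "lower_semicontinuous (ext_infinity D f)"
  unfolding lower_semicontinuous_def le_Liminf_iff
proof (intro allI impI)
  fix x :: real and y :: ereal
  assume y: "y < ext_infinity D f x"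
  have "eventually (\<lambda>z. y < ereal (f z)) (at x within D)"
  proof (cases "x \<in> D")
    case True
    then have "((\<lambda>z. ereal (f z)) \<longlongrightarrow> ereal (f x)) (at x within D)"
      using cont by (auto simp: continuous_on_def)
    then show ?thesis
      using y True by (intro order_tendstoD(1)) (simp_all add: ext_infinity_def)
  next
    case False
    then have "((\<lambda>z. ereal (f z)) \<longlongrightarrow> \<infinity>) (at x within D)"
    proof (cases "x \<in> closure D")
      case True
      then show ?thesis using lim False by (simp add: tendsto_PInfty_eq_at_top)
    next
      case False
      then have "at x within D = bot"
        by (simp add: closure_def trivial_limit_within)
      then show ?thesis by simp
    qed
    then show ?thesis
      using y False by (intro order_tendstoD(1)) (auto simp: ext_infinity_def)
  qed
  then have "eventually (\<lambda>z. z \<in> D \<longrightarrow> y < ereal (f z)) (at x)"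
    by (auto simp: eventually_at_filter elim: eventually_mono)
  then show "eventually (\<lambda>z. y < ext_infinity D f z) (at x)"
    by eventually_elim (use y in \<open>auto simp: ext_infinity_def\<close>)
qed

text \<open>Steepness can be checked on an explicit derivative \<open>f'\<close>: for
  \<open>0 < t < 1\<close> the point between a boundary point and an interior point is interior by
  convexity, and there \<open>f'\<close> agrees with \<open>deriv f\<close>.\<close>

lemma convex_legendreI:
  fixes f f' :: "real \<Rightarrow> real"
  assumes "convex D" and int: "interior D \<noteq> {}" and cont: "continuous_on D f"
    and der: "\<And>x. x \<in> interior D \<Longrightarrow> (f has_real_derivative f' x) (at x)"
    and "strict_mono_on (interior D) f'"
    and "\<And>x. x \<in> closure D - D \<Longrightarrow> filterlim f at_top (at x within D)"
    and steep: "\<And>x y. x \<in> frontier D \<Longrightarrow> y \<in> interior D \<Longrightarrow>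
      filterlim (\<lambda>t. f' (x + t * (y - x)) * (y - x)) at_bot (at_right 0)"
  shows "convex_legendre D f"
proof -
  have strict: "strictly_convex_on D f"
    using assms by (intro strictly_convex_on_if_strict_mono_deriv[where f' = f'])
  have "filterlim (\<lambda>t. deriv f (x + t * (y - x)) * (y - x)) at_bot (at_right 0)"
    if x: "x \<in> frontier D" and y: "y \<in> interior D" for x y
  proof -
    have "eventually (\<lambda>t. t \<in> {0<..<1}) (at_right (0::real))"
      by (intro eventually_at_right_real) simp
    then have "eventually (\<lambda>t. f' (x + t * (y - x)) * (y - x) =
        deriv f (x + t * (y - x)) * (y - x)) (at_right 0)"
    proof eventually_elim
      case (elim t)
      have "x \<in> closure D" using x by (simp add: frontier_def)
      then have "x - t *\<^sub>R (x - y) \<in> interior D"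
        using elim y \<open>convex D\<close> by (intro mem_interior_closure_convex_shrink) auto
      moreover have "x - t *\<^sub>R (x - y) = x + t * (y - x)"
        by (simp add: algebra_simps)
      ultimately show ?case
        using der DERIV_imp_deriv by metis
    qed
    then show ?thesis
      using steep[OF x y] by (rule filterlim_cong[OF refl refl, THEN iffD1])
  qed
  moreover have "f differentiable (at x)" if "x \<in> interior D" for x
    using der that real_differentiable_def by blast
  moreover have "D \<noteq> {}"
    using int by auto
  moreover have "strictly_convex_on (interior D) f"
    using strict interior_subset convex_interior[OF \<open>convex D\<close>] by (rule strictly_convex_on_subset)
  ultimately show ?thesis
    using assms(6) int strict cont unfolding convex_legendre_def
    by (auto intro!: strictly_convex_on_imp_convex_on lower_semicontinuous_ext_infinity)
qed

text \<open>As \<open>y - a\<close> is negative, the moving point approaches \<open>a\<close> from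
  the left, and the same factor turns the limit from plus to minus infinity.\<close>

lemma steep_at_left:
  fixes g :: "real \<Rightarrow> real"
  assumes "filterlim g at_top (at_left a)" "y < a"
  shows "filterlim (\<lambda>t. g (a + t * (y - a)) * (y - a)) at_bot (at_right 0)"
proof -
  have "filterlim (\<lambda>t. a + t * (y - a)) (at_left a) (at_right 0)"
    unfolding filterlim_at
    using assms(2) by (auto intro!: tendsto_eq_intros eventually_at_rightI[of 0 1] mult_pos_neg)
  from filterlim_compose[OF assms(1) this] show ?thesis
    using assms(2) by (auto simp: mult.commute intro!: filterlim_tendsto_neg_mult_at_bot[OF tendsto_const])
qed

text \<open>Reflection at the origin: \<open>- g (- x)\<close> tends to plus infinity from the left
  at \<open>- a\<close>.\<close>

lemma steep_at_right:
  fixes g :: "real \<Rightarrow> real"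
  assumes "filterlim g at_bot (at_right a)" "a < y"
  shows "filterlim (\<lambda>t. g (a + t * (y - a)) * (y - a)) at_bot (at_right 0)"
  using steep_at_left[of "\<lambda>x. - g (- x)" "- a" "- y"] assms
  by (simp add: filterlim_at_left_to_right filterlim_uminus_at_top algebra_simps)

text \<open>Only points strictly between \<open>a\<close> and \<open>b\<close> need a derivative,
  and these are interior to \<open>D\<close>; the endpoints may lie on the boundary.\<close>

lemma has_integral_if_deriv_interior:
  fixes f f' :: "real \<Rightarrow> real"
  assumes "convex D" "continuous_on D f"
    and der: "\<And>x. x \<in> interior D \<Longrightarrow> (f has_real_derivative f' x) (at x)"
    and ab: "a \<in> D" "b \<in> D" "a \<le> b"
  shows "(f' has_integral (f b - f a)) {a..b}"
proof (rule fundamental_theorem_of_calculus_interior[OF ab(3)])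
  have sub: "{a..b} \<subseteq> D"
    using assms(1) ab by (metis closed_segment_eq_real_ivl1 convex_contains_segment)
  then show "continuous_on {a..b} f"
    using assms(2) continuous_on_subset by blast
  have "{a<..<b} \<subseteq> interior D"
    using sub by (intro interior_maximal) auto
  then show "(f has_vector_derivative f' x) (at x)" if "x \<in> {a<..<b}" for x
    using der that by (auto simp: has_real_derivative_iff_has_vector_derivative)
qed

section \<open>Powers with exponents of odd denominator\<close>

text \<open>This is the source of all parities below: \<open>1 / (1 - a)\<close> becomes
  \<open>q / p\<close>, odd over odd, and \<open>(2 - a) / (1 - a)\<close> becomes
  \<open>(p + q) / p\<close>, even over odd.\<close>

lemma even_over_oddE:
  assumes "a \<in> even_over_odd"
  obtains p q :: int where "odd p" "odd q" "1 - a = of_int p / of_int q"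
proof -
  from assms obtain k l :: int where a: "a = of_int (2 * k) / of_int (2 * l + 1)"
    by (auto simp: even_over_odd_def)
  have "real_of_int (2 * l + 1) \<noteq> 0"
    by presburger
  then have "1 - a = of_int (2 * l + 1 - 2 * k) / of_int (2 * l + 1)"
    unfolding a by (simp add: field_simps)
  then show ?thesis
    by (intro that[of "2 * l + 1 - 2 * k" "2 * l + 1"]) auto
qed

text \<open>The even branch of \<open>rpow\<close> is tested first and has to be ruled out. At
  \<open>x = 0\<close> a positive exponent ensures the value 0 instead of
  \<open>undefined\<close>.\<close>

lemma rpow_uminus_odd:
  fixes p q :: int
  assumes "odd p" "odd q" "r = of_int p / of_int q" "x \<noteq> 0 \<or> r > 0"
  shows "rpow (- x) r = - rpow x r"
proof -
  \<comment> \<open>Cross-multiplying two such representations would equate an odd with an even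
    integer.\<close>
  have "\<not> (\<exists>p' q' :: int. odd q' \<and> even p' \<and> r = of_int p' / of_int q')"
  proof safe
    fix p' q' :: int
    assume *: "odd q'" "even p'" "r = of_int p' / of_int q'"
    have "q \<noteq> 0" "q' \<noteq> 0" using * assms by auto
    then have "real_of_int (p * q') = of_int (p' * q)"
      using *(3) assms(3) by (simp add: field_simps)
    then have "p * q' = p' * q" by linarith
    then show False using * assms(1,2) by (metis even_mult_iff)
  qed
  then show ?thesis
    using assms by (auto simp: rpow_def)
qed

lemma rpow_uminus_even:
  fixes p q :: int
  assumes "even p" "odd q" "r = of_int p / of_int q"
  shows "rpow (- x) r = rpow x r"
  using assms by (auto simp: rpow_def)

lemma exp_ext_uminus:
  assumes "a \<in> even_over_odd" "x \<noteq> 0 \<or> a < 1"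
  shows "exp_ext a (- x) = - exp_ext a x"
proof -
  obtain p q :: int where pq: "odd p" "odd q" "1 - a = of_int p / of_int q"
    using assms(1) by (rule even_over_oddE)
  have "a \<noteq> 1" using pq by auto
  moreover have "1 / (1 - a) = of_int q / of_int p" using pq by simp
  moreover have "(1 - a) * x \<noteq> 0 \<or> 1 / (1 - a) > 0" using assms(2) \<open>a \<noteq> 1\<close> by auto
  ultimately show ?thesis
    using rpow_uminus_odd[of q p "1 / (1 - a)" "(1 - a) * x"] pq(1,2)
    by (simp add: exp_ext_def)
qed

lemma Psi_uminus:
  assumes "a \<in> even_over_odd" "a \<noteq> 2"
  shows "Psi a (- x) = Psi a x"
proof -
  obtain p q :: int where pq: "odd p" "odd q" "1 - a = of_int p / of_int q"
    using assms(1) by (rule even_over_oddE)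
  have [simp]: "p \<noteq> 0" "q \<noteq> 0" using pq by auto
  have "a \<noteq> 1" using pq by auto
  moreover have "(2 - a) / (1 - a) = of_int (p + q) / of_int p"
  proof -
    \<comment> \<open>The exponent is \<open>1 + q / p\<close>, whose numerator \<open>p + q\<close>
      is even as a sum of two odd integers.\<close>
    have "(2 - a) / (1 - a) = 1 + 1 / (1 - a)" using \<open>a \<noteq> 1\<close> by (simp add: field_simps)
    then show ?thesis using pq(3) by (simp add: add_divide_distrib)
  qed
  ultimately show ?thesis
    using rpow_uminus_even[of "p + q" p "(2 - a) / (1 - a)" "(1 - a) * x"] pq(1,2) assms(2)
    by (auto simp: Psi_def)
qed

section \<open>The extended exponential function and its antiderivative\<close>

lemma exp_ext_eq_powr:
  assumes "a \<noteq> 1" "(1 - a) * x > 0"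
  shows "exp_ext a x = ((1 - a) * x) powr (1 / (1 - a))"
  using assms by (simp add: exp_ext_def rpow_def)

lemma Psi_eq_powr:
  assumes "a \<noteq> 1" "a \<noteq> 2" "(1 - a) * x > 0 \<or> x = 0 \<and> (a < 1 \<or> a > 2)"
  shows "Psi a x = 1 / (2 - a) * ((1 - a) * x) powr ((2 - a) / (1 - a))"
  using assms by (auto simp: Psi_def rpow_def zero_less_divide_iff)

lemma DERIV_Psi:
  assumes "a \<noteq> 1" "(1 - a) * x > 0"
  shows "(Psi a has_real_derivative exp_ext a x) (at x)"
proof (cases "a = 2")
  case True
  have "((\<lambda>x. - ln (- x)) has_real_derivative exp_ext a x) (at x)"
    using assms True by (auto intro!: derivative_eq_intros simp: exp_ext_eq_powr powr_minus_divide)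
  moreover have "(\<lambda>x. - ln (- x)) = Psi a"
    using True by (simp add: Psi_def fun_eq_iff)
  ultimately show ?thesis by simp
next
  case False
  have e: "(2 - a) / (1 - a) - 1 = 1 / (1 - a)"
    using assms(1) by (simp add: field_simps)
  have "((\<lambda>x. 1 / (2 - a) * ((1 - a) * x) powr ((2 - a) / (1 - a))) has_real_derivative exp_ext a x) (at x)"
    using assms False
    by (auto intro!: derivative_eq_intros simp: exp_ext_eq_powr e[symmetric] powr_diff)
  \<comment> \<open>The formula with \<open>powr\<close> is valid on this half-line; its openness
    lets the derivative pass to \<open>Psi\<close>.\<close>
  moreover have "open {x. (1 - a) * x > 0}"
    by (intro open_Collect_less continuous_intros)
  ultimately show ?thesis
    using assms False
    by (elim has_field_derivative_transform_within_open[where S = "{x. (1 - a) * x > 0}"])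
       (auto simp: Psi_eq_powr)
qed

text \<open>Where \<open>(1 - a) * x\<close> is negative, the derivative at \<open>- x\<close> is
  known and is carried back by evenness of \<open>Psi\<close> and oddness of
  \<open>exp_ext\<close>.\<close>

lemma DERIV_Psi_even_over_odd:
  assumes "a \<in> even_over_odd" "a \<noteq> 1" "a \<noteq> 2" "x \<noteq> 0"
  shows "(Psi a has_real_derivative exp_ext a x) (at x)"
proof (cases "(1 - a) * x > 0")
  case True
  then show ?thesis using assms by (intro DERIV_Psi)
next
  case False
  then have "(1 - a) * (- x) > 0"
    using assms by (auto simp: mult_less_0_iff zero_less_mult_iff)
  then have "(Psi a has_real_derivative exp_ext a (- x)) (at (- x))"
    using assms by (intro DERIV_Psi)
  then show ?thesis
    using assms by (simp add: DERIV_mirror exp_ext_uminus Psi_uminus)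
qed

text \<open>The difference quotient has absolute value a constant times \<open>\<bar>h\<bar>\<close>
  to the positive power \<open>1 / (1 - a)\<close>, hence tends to 0, the value of
  \<open>exp_ext a\<close> at 0.\<close>

lemma DERIV_Psi_0:
  assumes "a \<in> even_over_odd" "a < 1"
  shows "(Psi a has_real_derivative exp_ext a 0) (at 0)"
proof -
  \<comment> \<open>Evenness gives one formula for both signs of \<open>h\<close>.\<close>
  have psi: "Psi a h = 1 / (2 - a) * ((1 - a) * \<bar>h\<bar>) powr ((2 - a) / (1 - a))" for h
  proof -
    have "Psi a h = Psi a \<bar>h\<bar>"
      using assms by (simp add: abs_if Psi_uminus)
    then show ?thesis
      using assms by (cases "h = 0") (simp_all add: Psi_eq_powr)
  qed
  have e: "(2 - a) / (1 - a) = 1 / (1 - a) + 1"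
    using assms(2) by (simp add: field_simps)
  have "((\<lambda>h. (1 - a) / (2 - a) * ((1 - a) * \<bar>h\<bar>) powr (1 / (1 - a))) \<longlongrightarrow>
      (1 - a) / (2 - a) * ((1 - a) * \<bar>0\<bar>) powr (1 / (1 - a))) (at 0)"
    using assms(2) by (intro tendsto_intros tendsto_powr') auto
  moreover have "norm (Psi a h / h) = (1 - a) / (2 - a) * ((1 - a) * \<bar>h\<bar>) powr (1 / (1 - a))"
    if "h \<noteq> 0" for h
    using assms(2) that by (simp add: psi e powr_add abs_mult)
  then have "eventually (\<lambda>h. norm (Psi a h / h) =
      (1 - a) / (2 - a) * ((1 - a) * \<bar>h\<bar>) powr (1 / (1 - a))) (at 0)"
    by (simp add: eventually_at_filter)
  ultimately have "((\<lambda>h. norm (Psi a h / h)) \<longlongrightarrow> 0) (at 0)"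
    by (simp add: tendsto_cong)
  then have "((\<lambda>h. Psi a h / h) \<longlongrightarrow> 0) (at 0)"
    by (rule tendsto_norm_zero_cancel)
  then show ?thesis
    using assms(2) by (simp add: DERIV_def psi[of 0] exp_ext_def rpow_def)
qed

section \<open>Strict monotonicity of the extended exponential function\<close>

lemma exp_ext_less:
  assumes "a \<noteq> 1" "(1 - a) * x > 0" "(1 - a) * y > 0" "x < y"
  shows "exp_ext a x < exp_ext a y"
proof (cases "a < 1")
  case True
  then show ?thesis
    using assms by (simp add: exp_ext_eq_powr powr_less_mono2)
next
  case False
  \<comment> \<open>The negative factor \<open>1 - a\<close> reverses the order, and the negative
    exponent reverses it back.\<close>
  then have "(1 - a) * y < (1 - a) * x"
    using assms by (intro mult_strict_left_mono_neg) auto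
  then show ?thesis
    using assms False powr_less_mono2_neg[of "1 / (1 - a)" "(1 - a) * y" "(1 - a) * x"]
    by (simp add: exp_ext_eq_powr)
qed

lemma strict_mono_on_exp_ext_neg:
  assumes "1 < a"
  shows "strict_mono_on {..<0} (exp_ext a)"
  using assms by (auto intro!: strict_mono_onI exp_ext_less mult_neg_neg)

lemma strict_mono_on_exp_ext_pos:
  assumes "1 < a" "a \<in> even_over_odd"
  shows "strict_mono_on {0<..} (exp_ext a)"
proof (rule strict_mono_onI)
  fix x y :: real
  assume "x \<in> {0<..}" "y \<in> {0<..}" "x < y"
  then have "exp_ext a (- y) < exp_ext a (- x)"
    using strict_mono_on_exp_ext_neg[OF assms(1)] by (simp add: strict_mono_on_def)
  then show "exp_ext a x < exp_ext a y"
    using assms \<open>x \<in> _\<close> \<open>y \<in> _\<close> by (simp add: exp_ext_uminus)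
qed

lemma strict_mono_exp_ext:
  assumes "a < 1" "a \<in> even_over_odd"
  shows "strict_mono (exp_ext a)"
proof (rule strict_monoI)
  have pos: "exp_ext a x > 0" if "x > 0" for x
    using that assms(1) by (simp add: exp_ext_eq_powr)
  have le: "exp_ext a x < exp_ext a y" if "0 \<le> x" "x < y" for x y
  proof (cases "x = 0")
    case True
    then show ?thesis using pos that assms(1) by (simp add: exp_ext_def rpow_def)
  next
    case False
    then show ?thesis using that assms(1) by (auto intro!: exp_ext_less)
  qed
  have 0: "exp_ext a 0 = 0"
    using assms(1) by (simp add: exp_ext_def rpow_def)
  have neg: "exp_ext a (- x) = - exp_ext a x" for x
    using assms by (simp add: exp_ext_uminus)
  fix x y :: real
  assume "x < y"
  consider "0 \<le> x" | "y \<le> 0" | "x < 0" "0 < y" by linarith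
  then show "exp_ext a x < exp_ext a y"
  proof cases
    case 2
    then show ?thesis using le[of "- y" "- x"] \<open>x < y\<close> by (simp add: neg)
  next
    case 3
    then show ?thesis using pos[of "- x"] pos[of y] by (simp add: neg)
  qed (use le \<open>x < y\<close> in auto)
qed

section \<open>Limits and continuity at the boundary point 0\<close>

lemma filterlim_powr_neg_at_left:
  fixes c r :: real
  assumes "c < 0" "r < 0"
  shows "filterlim (\<lambda>x. (c * x) powr r) at_top (at_left 0)"
proof -
  have "filterlim (\<lambda>x. c * x) (at_right 0) (at_left 0)"
    unfolding filterlim_at using assms(1)
    by (auto intro!: tendsto_eq_intros eventually_at_leftI[of "-1"] mult_neg_neg)
  then have "filterlim (\<lambda>x. ln (c * x)) at_bot (at_left 0)"
    by (rule filterlim_compose[OF ln_at_0])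
  \<comment> \<open>The exponent \<open>r * ln (c * x)\<close> is written as a product of a positive
    constant and a function tending to plus infinity.\<close>
  then have "filterlim (\<lambda>x. - r * - ln (c * x)) at_top (at_left 0)"
    using assms(2)
    by (intro filterlim_tendsto_pos_mult_at_top[OF tendsto_const]) (auto simp: filterlim_uminus_at_bot)
  then have "filterlim (\<lambda>x. exp (r * ln (c * x))) at_top (at_left 0)"
    by (intro filterlim_compose[OF exp_at_top]) simp
  moreover have "eventually (\<lambda>x. exp (r * ln (c * x)) = (c * x) powr r) (at_left 0)"
    using assms(1) by (intro eventually_at_leftI[of "-1"]) (auto simp: powr_def)
  ultimately show ?thesis
    by (simp add: filterlim_cong)
qed

lemma filterlim_exp_ext_at_left:
  assumes "1 < a"
  shows "filterlim (exp_ext a) at_top (at_left 0)"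
proof -
  have "eventually (\<lambda>x. ((1 - a) * x) powr (1 / (1 - a)) = exp_ext a x) (at_left 0)"
    using assms by (intro eventually_at_leftI[of "-1"]) (auto simp: exp_ext_eq_powr mult_neg_neg)
  then show ?thesis
    using filterlim_powr_neg_at_left[of "1 - a" "1 / (1 - a)"] assms by (simp add: filterlim_cong)
qed

lemma filterlim_exp_ext_at_right:
  assumes "1 < a" "a \<in> even_over_odd"
  shows "filterlim (exp_ext a) at_bot (at_right 0)"
proof -
  have "filterlim (\<lambda>x. - exp_ext a (- x)) at_bot (at_right 0)"
    using filterlim_exp_ext_at_left[OF assms(1)]
    by (simp add: filterlim_at_left_to_right filterlim_uminus_at_top)
  moreover have "eventually (\<lambda>x. - exp_ext a (- x) = exp_ext a x) (at_right 0)"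
    using assms by (intro eventually_at_rightI[of 0 1]) (auto simp: exp_ext_uminus)
  ultimately show ?thesis
    by (simp add: filterlim_cong)
qed

text \<open>For \<open>a < 2\<close> the prefactor is positive and the exponent negative; at
  \<open>a = 2\<close> the logarithm takes over. This blow-up gives lower semicontinuity on the open
  half-line.\<close>

lemma filterlim_Psi_at_left:
  assumes "1 < a" "a \<le> 2"
  shows "filterlim (Psi a) at_top (at_left 0)"
proof (cases "a = 2")
  case True
  have "filterlim (\<lambda>x::real. - ln (- x)) at_top (at_left 0)"
    using ln_at_0 by (simp add: filterlim_at_left_to_right filterlim_uminus_at_top)
  then show ?thesis
    using True by (simp add: Psi_def[abs_def])
next
  case False
  then have "filterlim (\<lambda>x. 1 / (2 - a) * ((1 - a) * x) powr ((2 - a) / (1 - a))) at_top (at_left 0)"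
    using assms
    by (intro filterlim_tendsto_pos_mult_at_top[OF tendsto_const] filterlim_powr_neg_at_left)
       (auto simp: divide_less_0_iff)
  moreover have "eventually (\<lambda>x. 1 / (2 - a) * ((1 - a) * x) powr ((2 - a) / (1 - a)) = Psi a x) (at_left 0)"
    using assms False by (intro eventually_at_leftI[of "-1"]) (auto simp: Psi_eq_powr mult_neg_neg)
  ultimately show ?thesis
    by (simp add: filterlim_cong)
qed

lemma filterlim_Psi_at_right:
  assumes "1 < a" "a < 2" "a \<in> even_over_odd"
  shows "filterlim (Psi a) at_top (at_right 0)"
  using filterlim_Psi_at_left[of a] assms by (simp add: filterlim_at_left_to_right Psi_uminus)

text \<open>For \<open>a > 2\<close> the exponent \<open>(2 - a) / (1 - a)\<close> is positive, so
  the power is continuous up to its value 0 at the boundary.\<close>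

lemma continuous_on_Psi_nonpos:
  assumes "a > 2"
  shows "continuous_on {..0} (Psi a)"
proof -
  have "continuous_on {..0} (\<lambda>x. 1 / (2 - a) * ((1 - a) * x) powr ((2 - a) / (1 - a)))"
    using assms
    by (intro continuous_intros continuous_on_powr')
       (auto simp: mult_nonpos_nonpos zero_less_divide_iff)
  moreover have "1 / (2 - a) * ((1 - a) * x) powr ((2 - a) / (1 - a)) = Psi a x" if "x \<in> {..0}" for x
    using assms that by (intro Psi_eq_powr[symmetric]) (auto simp: zero_less_mult_iff)
  ultimately show ?thesis
    by (rule continuous_on_eq)
qed

lemma continuous_on_Psi_nonneg:
  assumes "a > 2" "a \<in> even_over_odd"
  shows "continuous_on {0..} (Psi a)"
proof -
  have "continuous_on {0..} (\<lambda>x. Psi a (- x))"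
    by (rule continuous_on_compose2[OF continuous_on_Psi_nonpos[OF assms(1)]])
       (auto intro!: continuous_intros)
  then show ?thesis
    using assms by (simp add: Psi_uminus)
qed

lemma frontier_half_line [simp]:
  "frontier {0::real<..} = {0}" "frontier {0::real..} = {0}"
  "frontier {..<0::real} = {0}" "frontier {..0::real} = {0}"
  by (auto simp: frontier_def interior_open)

theorem theorem5:
  fixes \<alpha> :: real and D :: "real set"
  assumes
    "((\<alpha> < 1 \<and> \<alpha> \<in> even_over_odd \<and> D = UNIV) \<or> (\<alpha> = 1 \<and> D = UNIV)) \<or>
     ((1 < \<alpha> \<and> \<alpha> < 2 \<and> \<alpha> \<in> even_over_odd \<and> D = {0<..}) \<or> (\<alpha> > 2 \<and> \<alpha> \<in> even_over_odd \<and> D = {0..})) \<or>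
     ((1 < \<alpha> \<and> \<alpha> \<le> 2 \<and> D = {..<0}) \<or> (\<alpha> > 2 \<and> D = {..0}))"
  shows "convex_legendre D (Psi \<alpha>) \<and>
    (\<forall>d\<in>D. \<forall>x\<in>D. d \<le> x \<longrightarrow> (exp_ext \<alpha> has_integral (Psi \<alpha> x - Psi \<alpha> d)) {d..x})"
proof -
  have [simp]: "interior {0::real<..} = {0<..}" "interior {..<0::real} = {..<0}"
    by (simp_all add: interior_open)
  have "convex D"
    using assms by auto
  have "1 \<in> interior D \<or> - 1 \<in> interior D"
    using assms by auto
  then have int: "interior D \<noteq> {}"
    by auto
  have der: "(Psi \<alpha> has_real_derivative exp_ext \<alpha> x) (at x)" if "x \<in> interior D" for x
  proof -
    have "(exp has_real_derivative exp x) (at x)" by (rule DERIV_exp)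
    moreover have "Psi 1 = exp" "exp_ext 1 = exp" by (auto simp: Psi_def exp_ext_def)
    \<comment> \<open>The point 0 is interior only when \<open>D\<close> is the whole line, that is
      for \<open>\<alpha> \<le> 1\<close>.\<close>
    ultimately show ?thesis
      using assms that DERIV_Psi_0[of \<alpha>] DERIV_Psi[of \<alpha> x] DERIV_Psi_even_over_odd[of \<alpha> x]
      by (cases "x = 0") (auto simp: mult_neg_neg)
  qed
  have cont: "continuous_on D (Psi \<alpha>)"
  proof (cases "\<alpha> > 2")
    case True
    then show ?thesis using assms continuous_on_Psi_nonpos continuous_on_Psi_nonneg by auto
  next
    case False
    \<comment> \<open>Up to \<open>\<alpha> = 2\<close> all domains are open, so differentiability
      already gives continuity.\<close>
    then have "open D" using assms by auto
    then have "interior D = D" by (rule interior_open)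
    then show ?thesis
      using der by (metis DERIV_isCont continuous_at_imp_continuous_on)
  qed
  have mono: "strict_mono_on (interior D) (exp_ext \<alpha>)"
  proof -
    have "strict_mono (exp_ext 1)" by (auto simp: exp_ext_def strict_mono_def)
    then show ?thesis
      using assms strict_mono_exp_ext strict_mono_on_exp_ext_neg strict_mono_on_exp_ext_pos by auto
  qed
  have lim: "filterlim (Psi \<alpha>) at_top (at x within D)" if "x \<in> closure D - D" for x
  proof -
    \<comment> \<open>Only the open half-lines miss a boundary point, namely 0; for closed
      \<open>D\<close> the claim is vacuous.\<close>
    consider "D = {0<..}" "1 < \<alpha>" "\<alpha> < 2" "\<alpha> \<in> even_over_odd" | "D = {..<0}" "1 < \<alpha>" "\<alpha> \<le> 2"
      | "closure D = D"
      using assms by auto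
    then show ?thesis
    proof cases
      case 1
      then have "x = 0" using that by auto
      then show ?thesis using 1 filterlim_Psi_at_right by simp
    next
      case 2
      then have "x = 0" using that by auto
      then show ?thesis using 2 filterlim_Psi_at_left by simp
    next
      case 3
      then show ?thesis using that by simp
    qed
  qed
  have steep: "filterlim (\<lambda>t. exp_ext \<alpha> (x + t * (y - x)) * (y - x)) at_bot (at_right 0)"
    if xy: "x \<in> frontier D" "y \<in> interior D" for x y
  proof -
    \<comment> \<open>The whole line has empty frontier, which leaves the half-lines with frontier
      point 0.\<close>
    consider "x = 0" "0 < y" "1 < \<alpha>" "\<alpha> \<in> even_over_odd" | "x = 0" "y < 0" "1 < \<alpha>"
      using assms xy by (elim disjE conjE) auto
    then show ?thesis
    proof cases
      case 1
      then show ?thesis using steep_at_right[OF filterlim_exp_ext_at_right, of \<alpha> y] by simp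
    next
      case 2
      then show ?thesis using steep_at_left[OF filterlim_exp_ext_at_left, of \<alpha> y] by simp
    qed
  qed
  show ?thesis
  proof (intro conjI ballI impI)
    show "convex_legendre D (Psi \<alpha>)"
      using \<open>convex D\<close> int cont der mono lim steep by (rule convex_legendreI)
    show "(exp_ext \<alpha> has_integral (Psi \<alpha> x - Psi \<alpha> d)) {d..x}" if "d \<in> D" "x \<in> D" "d \<le> x" for d x
      using \<open>convex D\<close> cont der that by (rule has_integral_if_deriv_interior)
  qed
qed

end
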